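(* Let $G$ be a finite, simple, undirected graph of girth $g\geq 3$ and minimum degree $\delta\geq 2$. Then $Z(G)\geq (g-2)(\delta-2)+2$.
   Context: The girth of $G$ is the length of a shortest cycle in $G$. A set $Z\subseteq V(G)$ is a zero forcing set if the elements of $V(G)\setminus Z$ admit a linear order $u_1,\ldots,u_k$ such that for every $i\in\{1,\ldots,k\}$ there is a vertex $v_i\in Z\cup\{u_j: j<i\}$ such that $u_i$ is the only neighbor of $v_i$ outside $Z\cup\{u_j:j<i\}$. The zero forcing number $Z(G)$ is the minimum order of a zero forcing set of $G$. *)

theory Defs
  imports
    Graph_Theory.Digraph
    Graph_Theory.Arc_Walk
    "HOL-Library.Extended_Nat"
begin

text \<open>
  A finite simple undirected graph is an instance of the locale \<^locale>\<open>graph\<close>: a finite digraph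
  without loops and parallel arcs whose adjacency relation is symmetric, every undirected edge
  being represented by its two orientations.  In particular, the degree of a vertex is its
  out-degree.
\<close>

text \<open>
  \<^const>\<open>pre_digraph.cycle\<close> also counts the closed walk of length two that runs along an edge and
  back. In a loopless graph without parallel arcs, the condition on the length removes exactly
  these. The girth of an acyclic graph is \<open>\<infinity>\<close>.
\<close>

definition girth :: "('a, 'b) pre_digraph \<Rightarrow> enat" where
  "girth G = (INF p \<in> {p. pre_digraph.cycle G p \<and> 3 \<le> length p}. enat (length p))"

text \<open>Unspecified for the graph without vertices.\<close>

definition min_degree :: "('a, 'b) pre_digraph \<Rightarrow> nat" where
  "min_degree G = Min (out_degree G ` verts G)"

definition neighborhood :: "('a, 'b) pre_digraph \<Rightarrow> 'a \<Rightarrow> 'a set" where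
  "neighborhood G v = {w. v \<rightarrow>\<^bsub>G\<^esub> w}"

text \<open>
  The list \<open>us\<close> is the linear order of the vertices outside \<open>Z\<close>; indices start at 0, so that
  \<open>set (take i us)\<close> consists of the vertices preceding \<open>us ! i\<close>.
\<close>

definition zero_forcing_set :: "('a, 'b) pre_digraph \<Rightarrow> 'a set \<Rightarrow> bool" where
  "zero_forcing_set G Z \<longleftrightarrow> Z \<subseteq> verts G \<and>
    (\<exists>us. distinct us \<and> set us = verts G - Z \<and>
      (\<forall>i < length us. \<exists>v \<in> Z \<union> set (take i us).
        neighborhood G v - (Z \<union> set (take i us)) = {us ! i}))"

text \<open>For a finite graph the minimum exists, as \<^term>\<open>verts G\<close> is a zero forcing set.\<close>

definition zero_forcing_number :: "('a, 'b) pre_digraph \<Rightarrow> nat" where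
  "zero_forcing_number G = Min (card ` {Z. zero_forcing_set G Z})"

end

theory Submission
  imports Defs
begin

text \<open>
  If \<open>S\<close> is the set of vertices performing the first \<open>t = g - 2\<close> forces, then after these forces
  the closed neighborhood of \<open>S\<close> is colored, and it suffices that it has at least
  \<open>t * (\<delta> - 1) + 2\<close> vertices. Contracting an edge inside \<open>S\<close> lowers \<open>t\<close> and the girth by at most
  one each and preserves the claim, so \<open>S\<close> may be assumed independent. Consider then the bipartite
  graph between \<open>S\<close> and its neighbors. A cycle through at most \<open>(t + 1) div 2\<close> vertices of \<open>S\<close>
  would be shorter than \<open>g\<close>, so every subset of \<open>S\<close> of this size spans a forest. Averaging over
  these subsets shows that the neighborhoods of the vertices of \<open>S\<close> overlap in at most \<open>2 * t - 2\<close>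
  elements, counted with multiplicity. The averaging breaks down for \<open>t = 2\<close>, and graphs of girth
  four are treated by choosing other forces than the first two.
\<close>

section \<open>Excess of a set system\<close>

text \<open>Each element of the union contributes the number of members containing it, minus one:
  the multiplicity lost to overlaps. Integers keep the difference from being truncated.\<close>

definition excess :: "('i \<Rightarrow> 'b set) \<Rightarrow> 'i set \<Rightarrow> int" where
  "excess F I = (\<Sum>i\<in>I. int (card (F i))) - int (card (\<Union>(F ` I)))"

lemma excess_remove:
  assumes "finite I" "i \<in> I" "\<And>j. j \<in> I \<Longrightarrow> finite (F j)"
  shows "excess F I = excess F (I - {i}) + int (card (F i \<inter> \<Union>(F ` (I - {i}))))"
proof -
  let ?U = "\<Union>(F ` (I - {i}))"
  have U: "\<Union>(F ` I) = F i \<union> ?U" using assms(2) by blast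
  have "finite ?U" using assms by auto
  then have "card (F i \<union> ?U) + card (F i \<inter> ?U) = card (F i) + card ?U"
    using card_Un_Int[of "F i" ?U] assms by simp
  moreover have "(\<Sum>j\<in>I. int (card (F j))) = int (card (F i)) + (\<Sum>j\<in>I - {i}. int (card (F j)))"
    using assms by (simp add: sum.remove)
  ultimately show ?thesis unfolding excess_def U by linarith
qed

text \<open>Double counting: an element lying in \<open>d\<close> members contributes
  \<open>d\<close> on the left if \<open>d \<ge> 2\<close> and nothing otherwise, while it
  contributes \<open>2 * (d - 1)\<close> on the right.\<close>

lemma sum_card_shared_le:
  assumes I: "finite I" and F: "\<And>i. i \<in> I \<Longrightarrow> finite (F i)"
  shows "(\<Sum>i\<in>I. int (card (F i \<inter> \<Union>(F ` (I - {i}))))) \<le> 2 * excess F I"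
proof -
  define U where "U = \<Union>(F ` I)"
  define d where "d x = card {i \<in> I. x \<in> F i}" for x
  have U: "finite U" using assms unfolding U_def by auto
  \<comment> \<open>The predicate is \<open>d x \<ge> 2\<close> for the shared elements and later
    \<open>True\<close> for the plain sum of cardinalities.\<close>
  have count: "(\<Sum>i\<in>I. int (card {x \<in> F i. P x})) = (\<Sum>x\<in>U. if P x then int (d x) else 0)" for P
  proof -
    have "(\<Sum>i\<in>I. int (card {x \<in> F i. P x})) = (\<Sum>i\<in>I. \<Sum>x\<in>U. if x \<in> F i \<and> P x then 1 else 0)"
    proof (rule sum.cong)
      fix i assume "i \<in> I"
      then have "{x \<in> F i. P x} = {x \<in> U. x \<in> F i \<and> P x}" unfolding U_def by auto
      then show "int (card {x \<in> F i. P x}) = (\<Sum>x\<in>U. if x \<in> F i \<and> P x then 1 else 0)"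
        using U by (simp add: sum.If_cases Int_def)
    qed simp
    also have "\<dots> = (\<Sum>x\<in>U. \<Sum>i\<in>I. if x \<in> F i \<and> P x then 1 else 0)" by (rule sum.swap)
    also have "\<dots> = (\<Sum>x\<in>U. if P x then int (d x) else 0)"
      using I by (intro sum.cong) (auto simp: d_def sum.If_cases Int_def)
    finally show ?thesis .
  qed
  have d1: "d x \<ge> 1" if "x \<in> U" for x
  proof -
    have "{i \<in> I. x \<in> F i} \<noteq> {}" using that unfolding U_def by auto
    then show ?thesis using I by (simp add: d_def Suc_le_eq card_gt_0_iff)
  qed
  have shared: "F i \<inter> \<Union>(F ` (I - {i})) = {x \<in> F i. d x \<ge> 2}" if "i \<in> I" for i
  proof -
    have "(\<exists>j\<in>I - {i}. x \<in> F j) \<longleftrightarrow> d x \<ge> 2" if x: "x \<in> F i" for x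
    proof -
      have "{j \<in> I. x \<in> F j} = insert i {j \<in> I - {i}. x \<in> F j}" using \<open>i \<in> I\<close> x by auto
      then have "d x = Suc (card {j \<in> I - {i}. x \<in> F j})" using I by (simp add: d_def)
      moreover have "card {j \<in> I - {i}. x \<in> F j} > 0 \<longleftrightarrow> (\<exists>j\<in>I - {i}. x \<in> F j)"
        using I by (auto simp: card_gt_0_iff)
      ultimately show ?thesis by auto
    qed
    then show ?thesis by blast
  qed
  have "(\<Sum>i\<in>I. int (card (F i \<inter> \<Union>(F ` (I - {i}))))) = (\<Sum>i\<in>I. int (card {x \<in> F i. d x \<ge> 2}))"
    by (intro sum.cong) (simp_all add: shared)
  also have "\<dots> = (\<Sum>x\<in>U. if d x \<ge> 2 then int (d x) else 0)" by (rule count)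
  also have "\<dots> \<le> (\<Sum>x\<in>U. 2 * (int (d x) - 1))" using d1 by (intro sum_mono) fastforce
  also have "\<dots> = 2 * ((\<Sum>x\<in>U. int (d x)) - int (card U))"
    by (simp add: sum_distrib_left [symmetric] sum_subtractf)
  also have "\<dots> = 2 * excess F I" using count[of "\<lambda>_. True"] by (simp add: excess_def U_def)
  finally show ?thesis .
qed

text \<open>The last hypothesis holds when the incidence graph of members and elements is a forest.
  Members are peeled off one at a time, each costing at most one unit of excess, down to a single
  member of excess 0.\<close>

lemma excess_forest_le:
  assumes "finite I" "I \<noteq> {}" "\<And>i. i \<in> I \<Longrightarrow> finite (F i)"
    and "\<And>J. J \<subseteq> I \<Longrightarrow> J \<noteq> {} \<Longrightarrow> \<exists>i\<in>J. card (F i \<inter> \<Union>(F ` (J - {i}))) \<le> 1"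
  shows "excess F I \<le> int (card I) - 1"
  using assms
proof (induction "card I" arbitrary: I rule: less_induct)
  case less
  obtain i where i: "i \<in> I" "card (F i \<inter> \<Union>(F ` (I - {i}))) \<le> 1"
    using less.prems(2,4) by blast
  show ?case
  proof (cases "I = {i}")
    case True
    then show ?thesis by (simp add: excess_def)
  next
    case False
    then have ne: "I - {i} \<noteq> {}" using i(1) by auto
    have lt: "card (I - {i}) < card I" using less.prems(1) i(1) by (rule card_Diff1_less)
    have "excess F (I - {i}) \<le> int (card (I - {i})) - 1"
      using lt ne less.prems by (intro less.hyps) auto
    then show ?thesis
      using excess_remove[of I i F] i less.prems(1,3) lt
      by (smt (verit) of_nat_1 of_nat_less_iff of_nat_le_iff)
  qed
qed

text \<open>
  A random subfamily of size \<open>t\<close> of a family of size \<open>n\<close> retains, in expectation, at least the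
  fraction \<open>t * (t - 1) / (n * (n - 1))\<close> of the excess. The induction passes through all sizes in
  between, removing one member at a time.
\<close>
lemma excess_average:
  assumes "finite I" "\<And>i. i \<in> I \<Longrightarrow> finite (F i)" "t \<ge> 2"
    and t: "\<And>J. J \<subseteq> I \<Longrightarrow> card J = t \<Longrightarrow> excess F J \<le> int t - 1"
    and "card I \<ge> t"
  shows "excess F I * int t \<le> int (card I) * (int (card I) - 1)"
  using assms
proof (induction "card I" arbitrary: I rule: less_induct)
  case less
  show ?case
  proof (cases "card I = t")
    case True
    then have "excess F I \<le> int t - 1" using less.prems(4)[of I] by simp
    then have "excess F I * int t \<le> (int t - 1) * int t" by (intro mult_right_mono) auto
    then show ?thesis using True by (simp add: mult.commute)
  next
    case False
    define n where "n = int (card I)"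
    have n: "n \<ge> 3" and gt: "card I > t" using False less.prems(3,5) by (auto simp: n_def)
    have step: "excess F (I - {i}) * int t \<le> (n - 1) * (n - 2)" if "i \<in> I" for i
    proof -
      have c: "card (I - {i}) = card I - 1" using that less.prems(1) by simp
      have "excess F (I - {i}) * int t \<le> int (card (I - {i})) * (int (card (I - {i})) - 1)"
        using c gt less.prems by (intro less.hyps) auto
      moreover have "int (card (I - {i})) = n - 1" using c gt by (simp add: n_def)
      ultimately show ?thesis by simp
    qed
    \<comment> \<open>Summed over all \<open>i\<close>, the losses from removing one member amount
      to at most \<open>2 * excess F I\<close>. Hence \<open>n - 2\<close> of the \<open>n\<close>
      copies of the excess survive; \<open>n \<ge> 3\<close> allows cancelling this factor at the
      end.\<close>
    have "(\<Sum>i\<in>I. excess F I) = (\<Sum>i\<in>I. excess F (I - {i}))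
        + (\<Sum>i\<in>I. int (card (F i \<inter> \<Union>(F ` (I - {i})))))"
      unfolding sum.distrib[symmetric]
      using less.prems(1,2) by (intro sum.cong refl excess_remove) auto
    then have "(n - 2) * excess F I \<le> (\<Sum>i\<in>I. excess F (I - {i}))"
      using sum_card_shared_le[of I F] less.prems(1,2) by (simp add: n_def algebra_simps)
    then have "(n - 2) * excess F I * int t \<le> (\<Sum>i\<in>I. excess F (I - {i})) * int t"
      by (intro mult_right_mono) auto
    also have "\<dots> \<le> (\<Sum>i\<in>I. (n - 1) * (n - 2))"
      unfolding sum_distrib_right by (intro sum_mono step)
    also have "\<dots> = (n - 2) * (n * (n - 1))" by (simp add: n_def algebra_simps)
    finally have "(n - 2) * (excess F I * int t) \<le> (n - 2) * (n * (n - 1))"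
      by (simp add: mult.assoc)
    then show ?thesis using n by (simp add: n_def mult_le_cancel_left)
  qed
qed

section \<open>Cycles and neighborhoods\<close>

text \<open>The first vertex is not repeated at the end, so the length of the list is the length of
  the cycle. The bound 3 excludes an edge traversed back and forth.\<close>

definition is_cycle :: "('a \<Rightarrow> 'a set) \<Rightarrow> 'a list \<Rightarrow> bool" where
  "is_cycle N xs \<longleftrightarrow>
    3 \<le> length xs \<and> distinct xs \<and> successively (\<lambda>x y. y \<in> N x) xs \<and> hd xs \<in> N (last xs)"

lemma is_cycle_mono:
  assumes "is_cycle N xs" "\<And>x. x \<in> set xs \<Longrightarrow> N x \<inter> set xs \<subseteq> N' x"
  shows "is_cycle N' xs"
proof -
  have ne: "xs \<noteq> []" using assms(1) by (auto simp: is_cycle_def)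
  have "successively (\<lambda>x y. y \<in> N' x) xs"
    using assms by (auto simp: is_cycle_def intro: successively_mono)
  moreover have "hd xs \<in> N' (last xs)"
    using assms ne unfolding is_cycle_def by (meson IntI hd_in_set last_in_set subsetD)
  ultimately show ?thesis using assms(1) by (simp add: is_cycle_def)
qed

lemma is_cycle_rotate:
  assumes "is_cycle N (ps @ qs)"
  shows "is_cycle N (qs @ ps)"
  using assms by (cases "ps = []"; cases "qs = []")
    (auto simp: is_cycle_def successively_append_iff)

text \<open>The last vertex of a longest path has a second neighbor, which lies on the path.\<close>
lemma cycle_if_two_neighbors:
  assumes W: "finite W" "W \<noteq> {}"
    and irrefl: "\<And>w. w \<notin> N w"
    and two: "\<And>w. w \<in> W \<Longrightarrow> \<exists>x\<in>W \<inter> N w. \<exists>y\<in>W \<inter> N w. x \<noteq> y"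
  obtains xs where "is_cycle N xs" "set xs \<subseteq> W"
proof -
  define P where "P xs \<longleftrightarrow> xs \<noteq> [] \<and> distinct xs \<and> successively (\<lambda>x y. y \<in> N x) xs \<and> set xs \<subseteq> W" for xs
  obtain w where "w \<in> W" using W by blast
  then have "P [w]" by (simp add: P_def)
  moreover have "length xs < Suc (card W)" if "P xs" for xs
    using that W(1) by (metis P_def card_mono distinct_card less_Suc_eq_le)
  ultimately obtain xs where xs: "P xs" and longest: "\<And>ys. P ys \<Longrightarrow> length ys \<le> length xs"
    using ex_has_greatest_nat[of P "[w]" length "Suc (card W)"] by auto
  define u where "u = last xs"
  have xs': "xs = butlast xs @ [u]" using xs by (simp add: P_def u_def)
  have "u \<in> W" using xs by (auto simp: P_def u_def)
  \<comment> \<open>One of two neighbors differs from the predecessor of \<open>u\<close>. If the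
    path is a single vertex, \<open>last (butlast xs)\<close> is the unspecified
    \<open>last []\<close>, which does no harm.\<close>
  then obtain x where x: "x \<in> W" "x \<in> N u" "x \<noteq> last (butlast xs)" using two by blast
  have "x \<in> set xs"
  proof (rule ccontr)
    assume "x \<notin> set xs"
    then have "P (xs @ [x])" using xs x by (auto simp: P_def u_def successively_append_iff)
    then show False using longest by fastforce
  qed
  moreover have "x \<noteq> u" using x irrefl by auto
  ultimately have "x \<in> set (butlast xs)" using xs' by (metis Un_iff empty_iff insert_iff list.set set_append)
  then obtain ps qs where b: "butlast xs = ps @ x # qs" by (meson split_list)
  \<comment> \<open>As \<open>x\<close> is not the predecessor of \<open>u\<close>, the cycle closed
    by \<open>x\<close> has at least three vertices.\<close>
  then have "qs \<noteq> []" using x(3) by auto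
  have eq: "xs = ps @ x # qs @ [u]" using xs' b by simp
  have "is_cycle N (x # qs @ [u])"
    using xs x(2) \<open>qs \<noteq> []\<close> unfolding eq P_def is_cycle_def
    by (cases qs) (auto simp: successively_append_iff)
  moreover have "set (x # qs @ [u]) \<subseteq> W" using xs unfolding eq P_def by auto
  ultimately show thesis by (rule that)
qed

section \<open>Lengths of lists and cycles without consecutive entries outside a set\<close>

lemma alternating_length_le:
  assumes "successively (\<lambda>x y. x \<in> T \<or> y \<in> T) xs"
  shows "length xs \<le> 2 * length (filter (\<lambda>x. x \<in> T) xs) + (if xs \<noteq> [] \<and> hd xs \<notin> T then 1 else 0)"
  using assms
proof (induction xs)
  case (Cons a xs)
  then show ?case by (cases xs) (auto split: if_splits)
qed simp

text \<open>Read from an end that lies in \<open>T\<close>, reversing if necessary, every entry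
  outside \<open>T\<close> directly follows an entry in \<open>T\<close>.\<close>

lemma alternating_cycle_length_le:
  assumes "successively (\<lambda>x y. x \<in> T \<or> y \<in> T) xs" "xs \<noteq> []" "hd xs \<in> T \<or> last xs \<in> T"
    and "distinct xs" "finite T"
  shows "length xs \<le> 2 * card T"
proof -
  have "length (filter (\<lambda>x. x \<in> T) xs) = card (set (filter (\<lambda>x. x \<in> T) xs))"
    using assms(4) by (metis distinct_card distinct_filter)
  also have "\<dots> \<le> card T" using assms(5) by (intro card_mono) auto
  finally have "length (filter (\<lambda>x. x \<in> T) xs) \<le> card T" .
  moreover have "length xs \<le> 2 * length (filter (\<lambda>x. x \<in> T) xs)"
    using assms(3)
  proof
    assume "hd xs \<in> T"
    then show ?thesis using alternating_length_le[OF assms(1)] by simp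
  next
    assume l: "last xs \<in> T"
    have "successively (\<lambda>x y. x \<in> T \<or> y \<in> T) (rev xs)"
      using assms(1) by (auto elim: successively_mono)
    from alternating_length_le[OF this] show ?thesis
      using l assms(2) by (simp add: hd_rev rev_filter[symmetric])
  qed
  ultimately show ?thesis by simp
qed

text \<open>A locally finite simple graph given by its neighborhood function on the whole type. A
  vertex is deleted by isolating it, so contraction does not change the type.\<close>

locale adjacency =
  fixes N :: "'a \<Rightarrow> 'a set"
  assumes sym: "w \<in> N v \<Longrightarrow> v \<in> N w"
    and irrefl: "v \<notin> N v"
    and finite_nbrs: "finite (N v)"
begin

text \<open>Between \<open>T\<close> and the set \<open>X\<close> of common neighbors of distinct
  vertices of \<open>T\<close>, all degrees are at least two, which yields a cycle; it has no two
  consecutive vertices outside \<open>T\<close>.\<close>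

lemma independent_short_cycle:
  assumes T: "finite T" "T \<noteq> {}" and indep: "\<And>v. v \<in> T \<Longrightarrow> N v \<inter> T = {}"
    and two: "\<And>v. v \<in> T \<Longrightarrow> card (N v \<inter> \<Union>(N ` (T - {v}))) \<ge> 2"
  obtains xs where "is_cycle N xs" "length xs \<le> 2 * card T"
proof -
  \<comment> \<open>The subgraph of the edges with an end in \<open>T\<close>.\<close>
  define M where "M v = (if v \<in> T then N v else N v \<inter> T)" for v
  define X where "X = {x. \<exists>v\<in>T. \<exists>w\<in>T. v \<noteq> w \<and> x \<in> N v \<inter> N w}"
  have "X \<subseteq> \<Union>(N ` T)" by (auto simp: X_def)
  then have fX: "finite X" using T finite_nbrs by (meson finite_UN finite_subset)
  have "\<exists>x\<in>(T \<union> X) \<inter> M w. \<exists>y\<in>(T \<union> X) \<inter> M w. x \<noteq> y" if w: "w \<in> T \<union> X" for w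
  proof (cases "w \<in> T")
    case True
    have "finite (N w \<inter> \<Union>(N ` (T - {w})))" using finite_nbrs by auto
    then obtain x y where xy: "x \<noteq> y" "x \<in> N w \<inter> \<Union>(N ` (T - {w}))" "y \<in> N w \<inter> \<Union>(N ` (T - {w}))"
      using two[OF True] by (metis card_le_Suc0_iff_eq not_less_eq_eq numeral_2_eq_2)
    then have "x \<in> X" "y \<in> X" using True unfolding X_def by blast+
    then show ?thesis using xy True unfolding M_def by auto
  next
    case False
    then obtain v v' where "v \<in> T" "v' \<in> T" "v \<noteq> v'" "w \<in> N v" "w \<in> N v'"
      using w unfolding X_def by auto
    then show ?thesis using sym False unfolding M_def by auto
  qed
  moreover have "w \<notin> M w" for w using irrefl by (simp add: M_def)
  ultimately obtain xs where xs: "is_cycle M xs" "set xs \<subseteq> T \<union> X"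
    using cycle_if_two_neighbors[of "T \<union> X" M] T fX by blast
  have "is_cycle N xs" using xs(1) by (rule is_cycle_mono) (auto simp: M_def)
  moreover have "length xs \<le> 2 * card T"
  proof (rule alternating_cycle_length_le)
    have "y \<in> M x \<Longrightarrow> x \<in> T \<or> y \<in> T" for x y by (auto simp: M_def split: if_splits)
    then show "successively (\<lambda>x y. x \<in> T \<or> y \<in> T) xs" "hd xs \<in> T \<or> last xs \<in> T"
      using xs(1) unfolding is_cycle_def by (blast intro: successively_mono)+
  qed (use xs T in \<open>auto simp: is_cycle_def\<close>)
  ultimately show thesis by (rule that)
qed

lemma independent_excess_le:
  assumes S: "finite S" "card S \<ge> 3" and indep: "\<And>v. v \<in> S \<Longrightarrow> N v \<inter> S = {}"
    and girth: "\<And>xs. is_cycle N xs \<Longrightarrow> card S + 2 \<le> length xs"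
  shows "excess N S \<le> 2 * int (card S) - 2"
proof (rule ccontr)
  \<comment> \<open>Half of \<open>card S\<close>, rounded up: small enough that
    \<open>2 * t < card S + 2\<close>, so that \<open>t\<close> vertices span no cycle, and large
    enough that averaging gives excess at most \<open>s * (s - 1) / t \<le> 2 * (s - 1)\<close> for
    \<open>s = card S\<close>.\<close>
  define t where "t = (card S + 1) div 2"
  assume "\<not> ?thesis"
  then have "2 * int (card S) - 1 \<le> excess N S" by simp
  then have "(2 * int (card S) - 1) * int t \<le> excess N S * int t" by (intro mult_right_mono) auto
  also have "\<dots> \<le> int (card S) * (int (card S) - 1)"
  proof (rule excess_average)
    fix J assume J: "J \<subseteq> S" "card J = t"
    have "excess N J \<le> int (card J) - 1"
    proof (rule excess_forest_le)
      fix K assume K: "K \<subseteq> J" "K \<noteq> {}"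
      have fK: "finite K" using K J S by (meson finite_subset)
      have "card K \<le> t" using K J S by (metis card_mono finite_subset)
      then have short: "2 * card K < card S + 2" by (simp add: t_def)
      show "\<exists>i\<in>K. card (N i \<inter> \<Union>(N ` (K - {i}))) \<le> 1"
      proof (rule ccontr)
        assume "\<not> ?thesis"
        then have "\<And>v. v \<in> K \<Longrightarrow> card (N v \<inter> \<Union>(N ` (K - {v}))) \<ge> 2" by force
        moreover have "\<And>v. v \<in> K \<Longrightarrow> N v \<inter> K = {}" using K J indep by blast
        ultimately obtain xs where "is_cycle N xs" "length xs \<le> 2 * card K"
          using independent_short_cycle[OF fK K(2)] by blast
        then show False using girth[of xs] short by simp
      qed
    qed (use J S finite_nbrs t_def in \<open>auto intro: finite_subset\<close>)
    then show "excess N J \<le> int t - 1" using J by simp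
  qed (use S finite_nbrs t_def in auto)
  finally have 1: "(2 * int (card S) - 1) * int t \<le> int (card S) * (int (card S) - 1)" .
  have "int (card S) \<le> 2 * int t" by (simp add: t_def)
  then have "(2 * int (card S) - 1) * int (card S) \<le> (2 * int (card S) - 1) * (2 * int t)"
    using S by (intro mult_left_mono) auto
  with 1 have "(2 * int (card S) - 1) * int (card S) \<le> 2 * (int (card S) * (int (card S) - 1))"
    by linarith
  then show False using S by (simp add: algebra_simps)
qed

lemma adj_iff: "v \<in> N w \<longleftrightarrow> w \<in> N v"
  using sym by blast

end

section \<open>Neighborhoods of small vertex sets\<close>

text \<open>The edge is contracted into \<open>v\<close>, and \<open>w\<close> survives as an
  isolated vertex.\<close>

definition contract :: "('a \<Rightarrow> 'a set) \<Rightarrow> 'a \<Rightarrow> 'a \<Rightarrow> 'a \<Rightarrow> 'a set" where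
  "contract N v w x = (if x = w then {} else if x = v then (N v \<union> N w) - {v, w}
    else if w \<in> N x then insert v (N x) - {w} else N x)"

lemma is_cycle_predecessor:
  assumes "is_cycle N xs" "x \<in> set xs"
  obtains y where "x \<in> N y"
proof -
  obtain ps qs where "xs = ps @ x # qs" using assms(2) by (meson split_list)
  then have "is_cycle N (x # qs @ ps)" using is_cycle_rotate[of N ps "x # qs"] assms(1) by simp
  then show thesis using that by (auto simp: is_cycle_def)
qed

context adjacency
begin

lemma adjacency_contract:
  assumes "w \<in> N v"
  shows "adjacency (contract N v w)"
proof
  fix x y z
  show "y \<in> contract N v w x \<Longrightarrow> x \<in> contract N v w y"
    using irrefl adj_iff by (auto simp: contract_def split: if_splits)
  show "x \<notin> contract N v w x"
    using irrefl by (auto simp: contract_def)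
  show "finite (contract N v w x)"
    using finite_nbrs by (auto simp: contract_def)
qed

text \<open>A cycle avoiding \<open>v\<close> is already a cycle of \<open>N\<close>. Otherwise its
  two edges at \<open>v\<close> come from edges at \<open>v\<close> or \<open>w\<close>: if both can
  be taken at the same end, that end replaces \<open>v\<close>; if not, the contracted edge is
  reinserted at the cost of one vertex.\<close>

lemma is_cycle_contract:
  assumes vw: "w \<in> N v" and xs: "is_cycle (contract N v w) xs"
  obtains ys where "is_cycle N ys" "length ys \<le> length xs + 1"
proof -
  have "w \<notin> contract N v w x" for x by (auto simp: contract_def)
  then have w: "w \<notin> set xs" using is_cycle_predecessor[OF xs] by metis
  show thesis
  proof (cases "v \<in> set xs")
    case False
    have "is_cycle N xs"
      using xs by (rule is_cycle_mono) (use False in \<open>auto simp: contract_def split: if_splits\<close>)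
    then show thesis using that by simp
  next
    case True
    then obtain ps qs where "xs = ps @ v # qs" by (meson split_list)
    then have c: "is_cycle (contract N v w) (v # qs @ ps)"
      using is_cycle_rotate[of _ ps "v # qs"] xs by simp
    define zs where "zs = qs @ ps"
    have len: "length xs = Suc (length zs)" and w: "w \<notin> set zs"
      using w \<open>xs = ps @ v # qs\<close> by (auto simp: zs_def)
    have zs: "zs \<noteq> []" "length zs \<ge> 2" "distinct zs" "v \<notin> set zs"
      "successively (\<lambda>x y. y \<in> contract N v w x) zs"
      "hd zs \<in> contract N v w v" "v \<in> contract N v w (last zs)"
      using c unfolding zs_def[symmetric]
      by (auto simp: is_cycle_def successively_Cons split: if_splits)
    have "successively (\<lambda>x y. y \<in> N x) zs"
      using zs(5) by (rule successively_mono) (use zs(4) w in \<open>auto simp: contract_def split: if_splits\<close>)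
    moreover have "hd zs \<in> N v \<or> hd zs \<in> N w" using zs(6) by (auto simp: contract_def split: if_splits)
    moreover have "v \<in> N (last zs) \<or> w \<in> N (last zs)"
      using zs(1,4,7) by (auto simp: contract_def split: if_splits)
    ultimately have "is_cycle N (v # zs) \<or> is_cycle N (w # zs) \<or> is_cycle N (v # zs @ [w])
        \<or> is_cycle N (w # zs @ [v])"
      using zs w vw sym irrefl by (auto simp: is_cycle_def successively_Cons successively_append_iff)
    then show thesis using that len by fastforce
  qed
qed

section \<open>Overlaps of neighborhoods in the absence of triangles and 4-cycles\<close>

lemma no_triangle:
  assumes "\<And>xs. is_cycle N xs \<Longrightarrow> 4 \<le> length xs" "b \<in> N a" "c \<in> N b" "a \<in> N c"
  shows False
proof -
  have "is_cycle N [a, b, c]" using assms(2-4) irrefl by (auto simp: is_cycle_def)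
  then show False using assms(1) by fastforce
qed

lemma no_4_cycle:
  assumes "\<And>xs. is_cycle N xs \<Longrightarrow> 5 \<le> length xs"
    and "b \<in> N a" "c \<in> N b" "d \<in> N c" "a \<in> N d" "a \<noteq> c" "b \<noteq> d"
  shows False
proof -
  have "is_cycle N [a, b, c, d]" using assms(2-7) irrefl by (auto simp: is_cycle_def)
  then show False using assms(1) by fastforce
qed

lemma card_nbrs_edge:
  assumes girth: "\<And>xs. is_cycle N xs \<Longrightarrow> 4 \<le> length xs" and vw: "w \<in> N v"
  shows "card (N v \<union> N w) = card (N v) + card (N w)"
proof (rule card_Un_disjoint)
  show "N v \<inter> N w = {}" using no_triangle[OF girth vw] sym by blast
qed (simp_all add: finite_nbrs)

text \<open>The base case of three vertices spanning an edge, where contraction would lead to the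
  excluded size two. The disjoint sets \<open>N v\<close> and \<open>N w\<close> together meet the
  closed neighborhood of \<open>z\<close> in at most two vertices.\<close>

lemma card_nbrs_edge_and_vertex_ge:
  assumes girth: "\<And>xs. is_cycle N xs \<Longrightarrow> 5 \<le> length xs"
    and vw: "w \<in> N v" and z: "z \<noteq> v" "z \<noteq> w"
  shows "card (N v) + card (N w) + card (N z) \<le> card (N v \<union> N w \<union> insert z (N z)) + 1"
proof -
  have n3: "b \<in> N a \<Longrightarrow> c \<in> N b \<Longrightarrow> a \<in> N c \<Longrightarrow> False" for a b c
    by (rule no_triangle[where a = a and b = b and c = c]) (fastforce dest: girth)+
  have n4: "b \<in> N a \<Longrightarrow> c \<in> N b \<Longrightarrow> d \<in> N c \<Longrightarrow> a \<in> N d \<Longrightarrow> a \<noteq> c \<Longrightarrow> b \<noteq> d \<Longrightarrow> False" for a b c d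
    using girth by (rule no_4_cycle)
  define I where "I = (N v \<union> N w) \<inter> insert z (N z)"
  have I: "card I \<le> 2"
  proof -
    \<comment> \<open>If \<open>z\<close> is adjacent to an end of the edge, only \<open>z\<close>
      and that end are shared. Otherwise each end has at most one common neighbor with
      \<open>z\<close>, by the absence of 4-cycles.\<close>
    consider "z \<in> N v" | "z \<in> N w" | "z \<notin> N v" "z \<notin> N w" by blast
    then show ?thesis
    proof cases
      case 1
      then have "I \<subseteq> {z, v}" unfolding I_def
        using vw z n3 n4 sym by (smt (verit) IntE UnE insertCI insertE subsetI)
      then show ?thesis using card_mono[of "{z, v}" I] by (simp add: card_insert_if split: if_splits)
    next
      case 2
      then have "I \<subseteq> {z, w}" unfolding I_def
        using vw z n3 n4 sym by (smt (verit) IntE UnE insertCI insertE subsetI)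
      then show ?thesis using card_mono[of "{z, w}" I] by (simp add: card_insert_if split: if_splits)
    next
      case 3
      have one: "card (N a \<inter> N z) \<le> 1" if "z \<noteq> a" for a
      proof -
        have "\<forall>x\<in>N a \<inter> N z. \<forall>y\<in>N a \<inter> N z. x = y"
          using n4[where a = a and c = z] that by (metis IntD1 IntD2 sym)
        then show ?thesis using finite_nbrs[of a] by (simp add: card_le_Suc0_iff_eq)
      qed
      have "I = (N v \<inter> N z) \<union> (N w \<inter> N z)" using 3 by (auto simp: I_def)
      then have "card I \<le> card (N v \<inter> N z) + card (N w \<inter> N z)" by (simp add: card_Un_le)
      then show ?thesis using one[of v] one[of w] z by linarith
    qed
  qed
  have "card (N v \<union> N w) + card (insert z (N z)) = card (N v \<union> N w \<union> insert z (N z)) + card I"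
    unfolding I_def by (rule card_Un_Int) (simp_all add: finite_nbrs)
  moreover have "card (insert z (N z)) = card (N z) + 1"
    using irrefl finite_nbrs by simp
  moreover have "card (N v \<union> N w) = card (N v) + card (N w)"
    using vw girth by (intro card_nbrs_edge) force+
  ultimately show ?thesis using I by linarith
qed

end

text \<open>
  Two vertices are excluded because of the complete bipartite graphs, where two vertices on
  one side have the same neighbors.
\<close>
lemma card_closed_nbrs_ge:
  fixes N :: "'a \<Rightarrow> 'a set"
  assumes "adjacency N" "finite S" "S \<noteq> {}" "card S \<noteq> 2"
    and "\<And>xs. is_cycle N xs \<Longrightarrow> card S + 2 \<le> length xs"
  shows "(\<Sum>v\<in>S. card (N v)) + 2 \<le> card (S \<union> \<Union>(N ` S)) + card S"
  using assms
proof (induction "card S" arbitrary: N S rule: less_induct)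
  case less
  interpret adjacency N by fact
  note fin = less.prems(2) and girth = less.prems(5)
  have fU: "finite (\<Union>(N ` S))" using fin finite_nbrs by auto
  have pos: "card S \<ge> 1" using less.prems(2,3) by (simp add: Suc_le_eq card_gt_0_iff)
  consider (independent) "\<And>v. v \<in> S \<Longrightarrow> N v \<inter> S = {}"
    | (edge) v w where "v \<in> S" "w \<in> S" "w \<in> N v" by blast
  then show ?case
  proof cases
    case independent
    have "excess N S \<le> 2 * int (card S) - 2"
    proof (cases "card S = 1")
      case True
      then obtain v where "S = {v}" using card_1_singletonE by blast
      then show ?thesis by (simp add: excess_def)
    next
      case False
      then show ?thesis
        using pos less.prems independent by (intro independent_excess_le) auto
    qed
    moreover have "card (S \<union> \<Union>(N ` S)) = card S + card (\<Union>(N ` S))"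
      using fin fU independent by (intro card_Un_disjoint) auto
    moreover have "(\<Sum>v\<in>S. int (card (N v))) = int (\<Sum>v\<in>S. card (N v))" by simp
    ultimately show ?thesis unfolding excess_def by linarith
  next
    case edge
    have neq: "v \<noteq> w" using edge irrefl by auto
    have "card {v, w} \<le> card S" using edge fin by (intro card_mono) auto
    then have c3: "card S \<ge> 3" using neq less.prems(4) by simp
    show ?thesis
    proof (cases "card S = 3")
      case True
      then have "card (S - {v, w}) = 1" using edge neq fin by (simp add: card_Diff_subset)
      then obtain z where "S - {v, w} = {z}" using card_1_singletonE by blast
      then have S: "S = {v, w, z}" and z: "z \<noteq> v" "z \<noteq> w" using edge by auto
      have "S \<union> \<Union>(N ` S) = N v \<union> N w \<union> insert z (N z)"
        using edge sym[OF edge(3)] by (auto simp: S)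
      moreover have "card (N v) + card (N w) + card (N z) \<le> card (N v \<union> N w \<union> insert z (N z)) + 1"
        using edge(3) z girth True by (intro card_nbrs_edge_and_vertex_ge) auto
      moreover have "(\<Sum>v\<in>S. card (N v)) = card (N v) + card (N w) + card (N z)"
        using z neq by (simp add: S)
      ultimately show ?thesis using True by simp
    next
      case False
      \<comment> \<open>Contraction lowers the degree sum by exactly two, \<open>card S\<close> by
        one and the closed neighborhood by at least one, so the claim for \<open>S'\<close> yields
        that for \<open>S\<close>.\<close>
      define M where "M = contract N v w"
      define S' where "S' = S - {w}"
      have cS': "card S' = card S - 1" using edge fin by (simp add: S'_def)
      have tri: "b \<in> N a \<Longrightarrow> c \<in> N b \<Longrightarrow> a \<in> N c \<Longrightarrow> False" for a b c
        using girth c3 by (rule_tac no_triangle) force+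
      have IH: "(\<Sum>x\<in>S'. card (M x)) + 2 \<le> card (S' \<union> \<Union>(M ` S')) + card S'"
      proof (rule less.hyps)
        show "adjacency M" unfolding M_def using edge(3) by (rule adjacency_contract)
        fix xs assume "is_cycle M xs"
        then obtain ys where "is_cycle N ys" "length ys \<le> length xs + 1"
          using is_cycle_contract[OF edge(3)] unfolding M_def by blast
        then show "card S' + 2 \<le> length xs" using girth[of ys] cS' c3 by simp
      qed (use cS' c3 False fin edge neq in \<open>auto simp: S'_def\<close>)
      \<comment> \<open>Without triangles, no vertex is adjacent to both \<open>v\<close> and
        \<open>w\<close>, so other degrees do not change.\<close>
      have Mx: "card (M x) = card (N x)" if x: "x \<in> S' - {v}" for x
      proof (cases "w \<in> N x")
        case True
        then have "v \<notin> N x" using tri edge(3) sym by blast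
        then have "card (insert v (N x) - {w}) = card (N x)"
          using True finite_nbrs neq by simp
        then show ?thesis using x True by (auto simp: M_def contract_def S'_def)
      qed (use x in \<open>auto simp: M_def contract_def S'_def\<close>)
      have "card (M v) = card (N v \<union> N w) - 2"
        using edge(3) sym neq finite_nbrs by (simp add: M_def contract_def card_Diff_subset)
      moreover have "card (N v \<union> N w) = card (N v) + card (N w)"
        using edge(3) girth c3 by (intro card_nbrs_edge) force+
      moreover have "card {v, w} \<le> card (N v \<union> N w)"
        using edge(3) sym finite_nbrs by (intro card_mono) auto
      ultimately have Mv: "card (M v) + 2 = card (N v) + card (N w)" using neq by simp
      have "(\<Sum>x\<in>S'. card (M x)) = card (M v) + (\<Sum>x\<in>S' - {v}. card (M x))"
        using edge neq fin by (intro sum.remove) (auto simp: S'_def)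
      moreover have "(\<Sum>x\<in>S. card (N x)) = card (N w) + (card (N v) + (\<Sum>x\<in>S' - {v}. card (N x)))"
        using edge neq fin by (simp add: S'_def sum.remove[of S w] sum.remove[of "S - {w}" v])
      ultimately have sums: "(\<Sum>x\<in>S'. card (M x)) + 2 = (\<Sum>x\<in>S. card (N x))"
        using Mx Mv by simp
      have "S' \<union> \<Union>(M ` S') \<subseteq> (S \<union> \<Union>(N ` S)) - {w}"
        using edge by (auto simp: S'_def M_def contract_def split: if_splits)
      then have "card (S' \<union> \<Union>(M ` S')) \<le> card ((S \<union> \<Union>(N ` S)) - {w})"
        using fin fU by (intro card_mono) auto
      also have "\<dots> = card (S \<union> \<Union>(N ` S)) - 1" using edge fin fU by simp
      finally show ?thesis using IH sums cS' c3 fin fU card_mono[of "S \<union> \<Union>(N ` S)" S]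
        by auto
    qed
  qed
qed

section \<open>Forcing processes\<close>

text \<open>\<open>B i\<close> is the colored set after \<open>i\<close> forces, and the next force
  is that of \<open>u i\<close> by \<open>v i\<close>.\<close>

locale forcing = adjacency N for N :: "'a \<Rightarrow> 'a set" +
  fixes V :: "'a set" and B :: "nat \<Rightarrow> 'a set" and v u :: "nat \<Rightarrow> 'a" and k :: nat and \<delta> :: nat
  assumes finite_V: "finite V" and V_ne: "V \<noteq> {}"
    and N_subset: "N x \<subseteq> V"
    and min_deg: "x \<in> V \<Longrightarrow> \<delta> \<le> card (N x)" and \<delta>: "\<delta> \<ge> 2"
    and B_k: "B k = V"
    and B_Suc: "i < k \<Longrightarrow> B (Suc i) = insert (u i) (B i)"
    and u_notin: "i < k \<Longrightarrow> u i \<notin> B i"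
    and v_in: "i < k \<Longrightarrow> v i \<in> B i"
    and force: "i < k \<Longrightarrow> N (v i) - B i = {u i}"
begin

lemma B_mono: "i \<le> j \<Longrightarrow> j \<le> k \<Longrightarrow> B i \<subseteq> B j"
proof (induction j)
  case (Suc j)
  then show ?case using B_Suc[of j] by (cases "i = Suc j") auto
qed simp

lemma B_subset: "i \<le> k \<Longrightarrow> B i \<subseteq> V"
  using B_mono[of i k] B_k by simp

lemma finite_B: "i \<le> k \<Longrightarrow> finite (B i)"
  using B_subset finite_V by (rule finite_subset)

lemma card_B: "i \<le> k \<Longrightarrow> card (B i) = card (B 0) + i"
proof (induction i)
  case (Suc i)
  then show ?case using B_Suc[of i] u_notin[of i] finite_B[of i] by simp
qed simp

lemma u_adj: "i < k \<Longrightarrow> u i \<in> N (v i)"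
  using force by blast

lemma N_v_subset: "i < j \<Longrightarrow> j \<le> k \<Longrightarrow> N (v i) \<subseteq> B j"
  using force[of i] B_Suc[of i] B_mono[of "Suc i" j] by fastforce

lemma v_in_B: "i < k \<Longrightarrow> i \<le> j \<Longrightarrow> j \<le> k \<Longrightarrow> v i \<in> B j"
  using v_in B_mono by blast

lemma u_in_B: "i < j \<Longrightarrow> j \<le> k \<Longrightarrow> u i \<in> B j"
  using u_adj[of i] N_v_subset[of i j] by auto

lemma u_notin_N: "i < j \<Longrightarrow> j < k \<Longrightarrow> u j \<notin> N (v i)"
  using N_v_subset[of i j] u_notin[of j] by auto

text \<open>Once a vertex has forced, all its neighbors are colored, so it never forces
  again.\<close>

lemma v_inj: "inj_on v {..<k}"
  by (rule linorder_inj_onI') (metis lessThan_iff u_adj u_notin_N)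

lemma u_inj: "inj_on u {..<k}"
  by (rule linorder_inj_onI') (metis lessThan_iff less_imp_le u_in_B u_notin)

text \<open>The closed neighborhood of the first \<open>t\<close> forcing vertices lies in
  \<open>B t\<close>, which exceeds the initial set by \<open>t\<close> vertices.\<close>

lemma card_initial_ge:
  assumes t: "t \<ge> 1" "t \<noteq> 2" and girth: "\<And>xs. is_cycle N xs \<Longrightarrow> t + 2 \<le> length xs"
  shows "t * (\<delta> - 2) + 2 \<le> card (B 0)"
proof -
  have bound: "t * (\<delta> - 2) + 2 + t \<le> card (S \<union> \<Union>(N ` S))" if S: "S \<subseteq> V" "card S = t" for S
  proof -
    have "finite S" using S finite_V by (meson finite_subset)
    moreover have "S \<noteq> {}" using S(2) t(1) by auto
    ultimately have "(\<Sum>x\<in>S. card (N x)) + 2 \<le> card (S \<union> \<Union>(N ` S)) + t"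
      using card_closed_nbrs_ge[OF adjacency_axioms, of S] t girth S(2) by auto
    moreover have "t * \<delta> \<le> (\<Sum>x\<in>S. card (N x))"
      using sum_bounded_below[of S \<delta> "\<lambda>x. card (N x)"] S min_deg by auto
    moreover have "t * \<delta> = t * (\<delta> - 2) + 2 * t"
      using \<delta> by (simp add: diff_mult_distrib2)
    ultimately show ?thesis by linarith
  qed
  show ?thesis
  proof (cases "t \<le> k")
    case True
    define S where "S = v ` {..<t}"
    have "S \<union> \<Union>(N ` S) \<subseteq> B t"
      using v_in_B N_v_subset True unfolding S_def by fastforce
    then have "card (S \<union> \<Union>(N ` S)) \<le> card (B t)" by (rule card_mono[OF finite_B[OF True]])
    moreover have "card S = t"
      unfolding S_def using inj_on_subset[OF v_inj, of "{..<t}"] True by (simp add: card_image)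
    moreover have "S \<subseteq> V" using \<open>S \<union> _ \<subseteq> B t\<close> B_subset[OF True] by blast
    ultimately show ?thesis using bound[of S] card_B[OF True] by simp
  next
    case False
    \<comment> \<open>With fewer than \<open>t\<close> forces, any \<open>t\<close> vertices serve,
      since \<open>V\<close> has fewer than \<open>card (B 0) + t\<close> vertices. A cycle shows
      that \<open>V\<close> has \<open>t\<close> vertices at all.\<close>
    have "\<exists>x\<in>V \<inter> N w. \<exists>y\<in>V \<inter> N w. x \<noteq> y" if "w \<in> V" for w
    proof -
      have "\<not> card (N w) \<le> Suc 0" using min_deg[OF that] \<delta> by simp
      then show ?thesis using N_subset finite_nbrs by (auto simp: card_le_Suc0_iff_eq)
    qed
    then obtain xs where xs: "is_cycle N xs" "set xs \<subseteq> V"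
      using cycle_if_two_neighbors[OF finite_V V_ne, of N] irrefl by blast
    have "length xs = card (set xs)" using xs(1) by (simp add: is_cycle_def distinct_card)
    also have "\<dots> \<le> card V" using finite_V xs(2) by (rule card_mono)
    finally have "t \<le> card V" using girth[OF xs(1)] by simp
    then obtain S where S: "S \<subseteq> V" "card S = t" using obtain_subset_with_card_n by metis
    have "S \<union> \<Union>(N ` S) \<subseteq> V" using S N_subset by auto
    then have "card (S \<union> \<Union>(N ` S)) \<le> card V" using finite_V by (intro card_mono)
    then show ?thesis using bound[OF S] card_B[of k] B_k False by simp
  qed
qed

text \<open>
  Before the first force by a neighbor of an earlier forcing vertex, the forcing vertices are
  independent, and each other one of them accounts for one colored vertex (itself or the one it forces)
  outside the disjoint neighborhoods of the two adjacent forcing vertices.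
\<close>
lemma card_initial_ge_triangle_free:
  assumes girth: "\<And>xs. is_cycle N xs \<Longrightarrow> 4 \<le> length xs"
  shows "2 * \<delta> \<le> card (B 0) + 2"
proof -
  have disj: "N x \<inter> N y = {}" if "y \<in> N x" for x y
    using no_triangle[OF girth that] sym by blast
  have two: "2 * \<delta> \<le> card (N x \<union> N y)" if "x \<in> V" "y \<in> V" "y \<in> N x" for x y
    using card_nbrs_edge[OF girth that(3)] min_deg[OF that(1)] min_deg[OF that(2)] by simp
  have vV: "v i \<in> V" if "i < k" for i
    using v_in[OF that] B_subset[of i] that by auto
  show ?thesis
  proof (cases "\<exists>i<k. \<exists>j<i. v i \<in> N (v j)")
    case True
    define i where "i = (LEAST i. i < k \<and> (\<exists>j<i. v i \<in> N (v j)))"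
    have i: "i < k" "\<exists>j<i. v i \<in> N (v j)"
      using LeastI_ex[OF True] unfolding i_def by auto
    have "v m \<notin> N (v l)" if "l < m" "m < i" for l m
      using not_less_Least[of m "\<lambda>i. i < k \<and> (\<exists>j<i. v i \<in> N (v j))"] that i(1)
      unfolding i_def[symmetric] by auto
    then have indep: "v m \<notin> N (v l)" if "l < i" "m < i" for l m
      using that irrefl sym by (metis linorder_neqE_nat)
    \<comment> \<open>The least choice matters: any other forcing vertex \<open>v l\<close> adjacent
      to \<open>v i\<close> has \<open>l > j\<close>, so \<open>u l\<close> is still uncolored after
      the force by \<open>v j\<close> and lies outside \<open>N (v j)\<close>.\<close>
    define j where "j = (LEAST j. j < i \<and> v i \<in> N (v j))"
    have j: "j < i" "v i \<in> N (v j)"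
      using LeastI_ex[OF i(2)] unfolding j_def by auto
    have j_min: "v i \<notin> N (v l)" if "l < j" for l
      using not_less_Least[of l "\<lambda>j. j < i \<and> v i \<in> N (v j)"] that j(1)
      unfolding j_def[symmetric] by auto
    define L where "L = {..<i} - {j}"
    define f where "f l = (if v l \<in> N (v i) then u l else v l)" for l
    have "inj_on f L"
    proof (rule inj_onI)
      fix l m assume lm: "l \<in> L" "m \<in> L" "f l = f m"
      then have k: "l < i" "m < i" "l < k" "m < k" using i by (auto simp: L_def)
      \<comment> \<open>The two kinds of values of \<open>f\<close> cannot collide:
        \<open>u l\<close> is a neighbor of \<open>v l\<close>, whereas \<open>v m\<close> is
        not.\<close>
      have "u l \<noteq> v m" "u m \<noteq> v l" using u_adj indep k by metis+
      then show "l = m"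
        using lm k inj_onD[OF v_inj, of l m] inj_onD[OF u_inj, of l m]
        by (auto simp: f_def split: if_splits)
    qed
    then have card_f: "card (f ` L) = i - 1" using j by (simp add: card_image L_def)
    have out: "f l \<notin> N (v j) \<union> N (v i)" if l: "l \<in> L" for l
    proof (cases "v l \<in> N (v i)")
      case True
      have "l < i" "l < k" using l i by (auto simp: L_def)
      have "j < l" using l True j_min[of l] sym by (metis DiffE L_def insertI1 linorder_neqE_nat)
      then have "u l \<notin> N (v j)" using \<open>l < k\<close> by (rule u_notin_N)
      moreover have "u l \<notin> N (v i)" using disj[OF True] u_adj[OF \<open>l < k\<close>] by blast
      ultimately show ?thesis using True by (simp add: f_def)
    next
      case False
      then show ?thesis using indep[of j l] j l by (auto simp: f_def L_def)
    qed
    have sub: "f ` L \<union> (N (v j) \<union> N (v i)) \<subseteq> B (Suc i)"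
    proof -
      have "f l \<in> B (Suc i)" if "l \<in> L" for l
        using that i v_in_B[of l "Suc i"] u_in_B[of l "Suc i"] by (auto simp: f_def L_def)
      then show ?thesis using N_v_subset[of j "Suc i"] N_v_subset[of i "Suc i"] i j by auto
    qed
    have "card (f ` L \<union> (N (v j) \<union> N (v i))) = (i - 1) + card (N (v j) \<union> N (v i))"
      unfolding card_f[symmetric]
      using out finite_nbrs by (intro card_Un_disjoint) (auto simp: L_def)
    moreover have "card (f ` L \<union> (N (v j) \<union> N (v i))) \<le> card (B (Suc i))"
      using sub finite_B i by (intro card_mono) auto
    moreover have "card (B (Suc i)) = card (B 0) + Suc i" using i by (intro card_B) auto
    moreover have "2 * \<delta> \<le> card (N (v j) \<union> N (v i))"
      using i j vV by (intro two) auto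
    \<comment> \<open>The count is
      \<open>(i - 1) + 2 * \<delta> \<le> card (B 0) + i + 1\<close>.\<close>
    ultimately show ?thesis using j by linarith
  next
    case False
    then have indep: "v m \<notin> N (v l)" if "l < k" "m < k" for l m
      using that irrefl sym by (metis linorder_neqE_nat)
    show ?thesis
    proof (cases k)
      case 0
      obtain x where x: "x \<in> V" using V_ne by blast
      then have "N x \<noteq> {}" using min_deg[OF x] \<delta> by auto
      then obtain y where y: "y \<in> N x" by blast
      have "card (N x \<union> N y) \<le> card V" using N_subset finite_V by (intro card_mono) auto
      then show ?thesis using two[OF x _ y] y N_subset B_k 0 by fastforce
    next
      case (Suc m)
      \<comment> \<open>The vertices that never force are as many as those colored initially. They
        include all neighbors of the last forcing vertex \<open>v m\<close> and all neighbors of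
        \<open>u m\<close> except \<open>v m\<close>, since no earlier forcing vertex is adjacent to
        \<open>u m\<close>.\<close>
      define W where "W = V - v ` {..<k}"
      have "card W = card V - k"
        unfolding W_def using finite_V vV v_inj by (subst card_Diff_subset) (auto simp: card_image)
      then have cW: "card W = card (B 0)" using card_B[of k] B_k by simp
      have "N (v m) \<union> (N (u m) - {v m}) \<subseteq> W"
      proof -
        have "v l \<notin> N (v m)" if "l < k" for l using indep[of m l] that Suc by simp
        moreover have "v l \<notin> N (u m) - {v m}" if "l < k" for l
          using u_notin_N[of l m] sym that Suc by (cases "l = m") auto
        ultimately show ?thesis using N_subset unfolding W_def by fast
      qed
      then have "card (N (v m) \<union> (N (u m) - {v m})) \<le> card W"
        using finite_V by (intro card_mono) (auto simp: W_def)
      moreover have um: "u m \<in> N (v m)" using Suc by (intro u_adj) auto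
      then have "card (N (v m) \<union> (N (u m) - {v m})) = card (N (v m)) + card (N (u m) - {v m})"
        using disj finite_nbrs by (intro card_Un_disjoint) auto
      moreover have "card (N (u m) - {v m}) \<ge> card (N (u m)) - 1"
        by (simp add: card_Diff_singleton_if)
      moreover have "\<delta> \<le> card (N (v m))" "\<delta> \<le> card (N (u m))"
        using um N_subset vV Suc by (auto intro!: min_deg)
      ultimately show ?thesis using cW by linarith
    qed
  qed
qed

end

section \<open>Translation from digraphs to neighborhood functions and forcing processes\<close>

section \<open>Digraphs\<close>

lemma (in wf_digraph) ex_cas_awalk_verts:
  assumes "xs \<noteq> []" "successively (\<lambda>x y. x \<rightarrow>\<^bsub>G\<^esub> y) xs"
  shows "\<exists>p. set p \<subseteq> arcs G \<and> cas (hd xs) p (last xs) \<and> awalk_verts (hd xs) p = xs"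
  using assms
proof (induction xs)
  case (Cons x xs)
  show ?case
  proof (cases "xs = []")
    case True
    then show ?thesis by (intro exI[of _ "[]"]) simp
  next
    case False
    then have adj: "x \<rightarrow>\<^bsub>G\<^esub> hd xs" and "successively (\<lambda>x y. x \<rightarrow>\<^bsub>G\<^esub> y) xs"
      using Cons.prems by (auto simp: successively_Cons)
    then obtain p where p: "set p \<subseteq> arcs G" "cas (hd xs) p (last xs)" "awalk_verts (hd xs) p = xs"
      using Cons.IH False by blast
    obtain e where "e \<in> arcs G" "tail G e = x" "head G e = hd xs" using adj by (rule reachableE)
    then show ?thesis using p False by (intro exI[of _ "e # p"]) simp
  qed
qed simp

lemma (in wf_digraph) cycle_of_is_cycle:
  assumes "is_cycle (neighborhood G) xs"
  obtains p where "cycle p" "length p = length xs"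
proof -
  have ne: "xs \<noteq> []" and xs: "distinct xs" "successively (\<lambda>x y. x \<rightarrow>\<^bsub>G\<^esub> y) xs" "last xs \<rightarrow>\<^bsub>G\<^esub> hd xs"
    using assms by (auto simp: is_cycle_def neighborhood_def)
  \<comment> \<open>Repeating the first vertex closes the walk; a walk has one vertex more than
    arcs, so \<open>p\<close> has the length of \<open>xs\<close>.\<close>
  then have "successively (\<lambda>x y. x \<rightarrow>\<^bsub>G\<^esub> y) (xs @ [hd xs])"
    by (simp add: successively_append_iff)
  then obtain p where p: "set p \<subseteq> arcs G" "cas (hd xs) p (hd xs)" "awalk_verts (hd xs) p = xs @ [hd xs]"
    using ex_cas_awalk_verts[of "xs @ [hd xs]"] ne by auto
  have len: "length p = length xs"
    using length_awalk_verts[of "hd xs" p] p(3) by simp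
  have "hd xs \<in> verts G" using xs(3) by (rule adj_in_verts)
  then have "awalk (hd xs) p (hd xs)" using p by (simp add: awalk_def)
  moreover have "distinct (tl (awalk_verts (hd xs) p))"
    using p(3) ne xs(1) by (cases xs) auto
  moreover have "p \<noteq> []" using len ne by auto
  ultimately have "cycle p" unfolding cycle_def by blast
  then show thesis using len by (rule that)
qed

lemma (in digraph) card_neighborhood: "card (neighborhood G x) = out_degree G x"
proof -
  have "neighborhood G x = head G ` out_arcs G x"
    by (auto simp: neighborhood_def arcs_ends_conv)
  moreover have "inj_on (head G) (out_arcs G x)"
    by (rule inj_onI) (auto intro: no_multi_arcs simp: arc_to_ends_def)
  ultimately show ?thesis by (simp add: card_image out_degree_def)
qed

lemma (in graph) adjacency_neighborhood: "adjacency (neighborhood G)"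
proof
  fix x y
  show "y \<in> neighborhood G x \<Longrightarrow> x \<in> neighborhood G y"
    using arcs_ends_symmetric[OF sym_arcs] by (simp add: neighborhood_def)
  show "x \<notin> neighborhood G x" using adj_not_same by (auto simp: neighborhood_def)
  show "finite (neighborhood G x)"
    by (rule finite_subset[of _ "verts G"]) (auto simp: neighborhood_def dest: adj_in_verts)
qed

lemma (in graph) zero_forcing_set_forcing:
  assumes "zero_forcing_set G Z" "verts G \<noteq> {}" "2 \<le> min_degree G"
  obtains B v u k where "forcing (neighborhood G) (verts G) B v u k (min_degree G)" "B 0 = Z"
proof -
  obtain us where us: "Z \<subseteq> verts G" "distinct us" "set us = verts G - Z"
    and "\<forall>i<length us. \<exists>v\<in>Z \<union> set (take i us). neighborhood G v - (Z \<union> set (take i us)) = {us ! i}"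
    using assms(1) by (auto simp: zero_forcing_set_def)
  then obtain v where v: "\<And>i. i < length us \<Longrightarrow> v i \<in> Z \<union> set (take i us)"
    "\<And>i. i < length us \<Longrightarrow> neighborhood G (v i) - (Z \<union> set (take i us)) = {us ! i}"
    by metis
  interpret adjacency "neighborhood G" by (rule adjacency_neighborhood)
  have "forcing (neighborhood G) (verts G) (\<lambda>i. Z \<union> set (take i us)) v ((!) us) (length us) (min_degree G)"
  proof
    fix x assume "x \<in> verts G"
    then show "min_degree G \<le> card (neighborhood G x)"
      unfolding min_degree_def card_neighborhood by (intro Min_le) auto
  next
    fix i assume i: "i < length us"
    then show "Z \<union> set (take (Suc i) us) = insert (us ! i) (Z \<union> set (take i us))"
      by (simp add: take_Suc_conv_app_nth)
    show "us ! i \<notin> Z \<union> set (take i us)" using v(2)[OF i] by blast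
  qed (use assms us v in \<open>auto simp: neighborhood_def dest: adj_in_verts\<close>)
  then show thesis by (rule that) simp
qed

lemma zero_forcing_number_attained:
  assumes "finite (verts G)"
  obtains Z where "zero_forcing_set G Z" "card Z = zero_forcing_number G"
proof -
  have "{Z. zero_forcing_set G Z} \<subseteq> Pow (verts G)" by (auto simp: zero_forcing_set_def)
  then have "finite {Z. zero_forcing_set G Z}" using assms by (simp add: finite_subset)
  moreover have "zero_forcing_set G (verts G)" by (auto simp: zero_forcing_set_def)
  ultimately have "zero_forcing_number G \<in> card ` {Z. zero_forcing_set G Z}"
    unfolding zero_forcing_number_def by (intro Min_in) auto
  then show thesis using that by auto
qed

theorem theorem4:
  fixes G :: "('a, 'b) pre_digraph" and g \<delta> :: nat
  assumes "graph G"
    and "girth G = enat g" and "g \<ge> 3"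
    and "min_degree G = \<delta>" and "\<delta> \<ge> 2"
  shows "zero_forcing_number G \<ge> (g - 2) * (\<delta> - 2) + 2"
proof -
  interpret graph G by fact
  obtain Z where Z: "zero_forcing_set G Z" "card Z = zero_forcing_number G"
    using finite_verts by (rule zero_forcing_number_attained)
  \<comment> \<open>The infimum over no cycles is \<open>\<infinity>\<close>, so finite girth
    provides a cycle and hence a vertex.\<close>
  have "\<exists>p. cycle p"
  proof (rule ccontr)
    assume "\<not> ?thesis"
    then have "girth G = \<infinity>" by (simp add: girth_def top_enat_def)
    then show False using assms(2) by simp
  qed
  then have "verts G \<noteq> {}" by (auto simp: cycle_def awalk_def)
  then obtain B v u k where "forcing (neighborhood G) (verts G) B v u k (min_degree G)" and B: "B 0 = Z"
    using zero_forcing_set_forcing Z(1) assms(4,5) by blast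
  then interpret forcing "neighborhood G" "verts G" B v u k \<delta> using assms(4) by simp
  have g: "g \<le> length xs" if xs: "is_cycle (neighborhood G) xs" for xs
  proof -
    obtain p where p: "cycle p" "length p = length xs" using xs by (rule cycle_of_is_cycle)
    moreover have "3 \<le> length xs" using xs by (simp add: is_cycle_def)
    ultimately have "girth G \<le> enat (length p)" unfolding girth_def by (intro INF_lower) simp
    then show ?thesis using assms(2) p(2) by simp
  qed
  show ?thesis
  \<comment> \<open>Girth four is the excluded case \<open>t = 2\<close> of
    \<open>card_initial_ge\<close>; the bound is then \<open>2 * (\<delta> - 2) + 2\<close>.\<close>
  proof (cases "g = 4")
    case True
    then show ?thesis using card_initial_ge_triangle_free g B Z(2) assms(5) by simp
  next
    case False
    then have "g - 2 \<ge> 1" "g - 2 \<noteq> 2" "g - 2 + 2 = g" using assms(3) by auto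
    then show ?thesis using card_initial_ge[of "g - 2"] g B Z(2) by simp
  qed
qed

end
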